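(* Let $\mathcal{X}$ be an infinite-dimensional complex Banach space and let $T$ be a bounded linear operator on $\mathcal{X}$ that is triangularizable, quasinilpotent and injective. Then $T$ has an almost-invariant half-space.
   Context: All subspaces of Banach spaces are assumed to be norm-closed. A subspace $\mathcal{Y}$ of $\mathcal{X}$ is a half-space if $\dim \mathcal{Y} = \dim(\mathcal{X}/\mathcal{Y}) = \infty$. A subspace $\mathcal{Y}$ is almost-invariant for a bounded linear operator $T$ on $\mathcal{X}$ if there is a finite-dimensional subspace $\mathcal{M}$ of $\mathcal{X}$ with $T\mathcal{Y} \subseteq \mathcal{Y} + \mathcal{M}$. An operator $T$ on $\mathcal{X}$ is triangularizable if there is a chain $\mathcal{C}$ of (closed) subspaces of $\mathcal{X}$ that is maximal with respect to inclusion (maximal as a chain of closed subspaces of $\mathcal{X}$) and such that each member of $\mathcal{C}$ is $T$-invariant. $T$ is quasinilpotent if its spectrum is $\{0\}$. *)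

theory Defs
  imports "HOL-Analysis.Analysis"
begin

(* The library has only real normed spaces. A complex normed space is a real one whose
   real scalar multiplication is the restriction of a complex one; 1 *C x = x then follows
   from the real case. *)

class complex_normed_vector = real_normed_vector +
  fixes scaleC :: "complex \<Rightarrow> 'a \<Rightarrow> 'a" (infixr "*C" 75)
  assumes scaleC_add_right: "a *C (x + y) = a *C x + a *C y"
    and scaleC_add_left: "(a + b) *C x = a *C x + b *C x"
    and scaleC_scaleC: "a *C (b *C x) = (a * b) *C x"
    and scaleR_scaleC: "r *\<^sub>R x = complex_of_real r *C x"
    and norm_scaleC: "norm (a *C x) = cmod a * norm x"

class complex_banach = complex_normed_vector + complete_space

subclass (in complex_banach) banach ..

lemma scaleC_one: "1 *C x = (x :: 'a :: complex_normed_vector)"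
  using scaleR_scaleC[of 1 x] by simp

global_interpretation complex_vector:
  vector_space "scaleC :: complex \<Rightarrow> 'a \<Rightarrow> 'a :: complex_normed_vector"
  defines cspan = complex_vector.span
    and csubspace = complex_vector.subspace
  by unfold_locales
    (simp_all add: scaleC_add_right scaleC_add_left scaleC_scaleC scaleC_one)

definition closed_csubspace :: "'a :: complex_normed_vector set \<Rightarrow> bool"
  where "closed_csubspace Y \<longleftrightarrow> csubspace Y \<and> closed Y"

definition finite_cdim :: "'a :: complex_normed_vector set \<Rightarrow> bool"
  where "finite_cdim Y \<longleftrightarrow> (\<exists>B. finite B \<and> cspan B = Y)"

definition coset :: "'a :: complex_normed_vector set \<Rightarrow> 'a \<Rightarrow> 'a set"
  where "coset Y x = {x + y | y. y \<in> Y}"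

(* For a subspace Y, range (coset Y) is the underlying set of the quotient space by Y.
   Linear combinations of cosets are formed on representatives, so coset Y ` cspan B
   is the linear span of the cosets coset Y b with b in B. *)
definition finite_cdim_quotient :: "'a :: complex_normed_vector set \<Rightarrow> bool"
  where "finite_cdim_quotient Y \<longleftrightarrow> (\<exists>B. finite B \<and> coset Y ` cspan B = range (coset Y))"

definition half_space :: "'a :: complex_normed_vector set \<Rightarrow> bool"
  where "half_space Y \<longleftrightarrow>
    closed_csubspace Y \<and> \<not> finite_cdim Y \<and> \<not> finite_cdim_quotient Y"

definition bounded_clinear :: "('a :: complex_normed_vector \<Rightarrow> 'a) \<Rightarrow> bool"
  where "bounded_clinear T \<longleftrightarrow> bounded_linear T \<and> Vector_Spaces.linear scaleC scaleC T"

definition almost_invariant :: "('a :: complex_normed_vector \<Rightarrow> 'a) \<Rightarrow> 'a set \<Rightarrow> bool"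
  where "almost_invariant T Y \<longleftrightarrow>
    closed_csubspace Y \<and>
    (\<exists>M. closed_csubspace M \<and> finite_cdim M \<and> T ` Y \<subseteq> {y + m | y m. y \<in> Y \<and> m \<in> M})"

definition triangularizable :: "('a :: complex_normed_vector \<Rightarrow> 'a) \<Rightarrow> bool"
  where "triangularizable T \<longleftrightarrow>
    (\<exists>\<C>. subset.maxchain {Y. closed_csubspace Y} \<C> \<and> (\<forall>Y\<in>\<C>. T ` Y \<subseteq> Y))"

definition spectrum :: "('a :: complex_normed_vector \<Rightarrow> 'a) \<Rightarrow> complex set"
  where "spectrum T = {z. \<not> (\<exists>S. bounded_clinear S \<and>
    (\<forall>x. S (T x - z *C x) = x) \<and> (\<forall>x. T (S x) - z *C S x = x))}"

definition quasinilpotent :: "('a :: complex_normed_vector \<Rightarrow> 'a) \<Rightarrow> bool"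
  where "quasinilpotent T \<longleftrightarrow> spectrum T = {0}"

end

theory Submission
  imports Defs "HOL-Computational_Algebra.Fundamental_Theorem_Algebra"
begin

text \<open>
  If no member of the triangularizing chain is a half-space, every nonzero member has finite
  codimension, because an injective quasinilpotent operator has no nonzero finite-dimensional
  invariant subspace; by maximality these members intersect in \<open>{0}\<close>, and \<open>T\<close> is nilpotent
  modulo each of them. Hence for \<open>e \<noteq> 0\<close> the orbit \<open>T ^^ n e\<close> has bounded biorthogonal functionals
  \<open>g n\<close>, and these vanish on the range of some power of \<open>T\<close>. They therefore take the value
  \<open>l ^ (n + 1)\<close> at \<open>h = (1/l - T)\<^sup>-\<^sup>1 e\<close>. The closed span \<open>Y\<close> of such vectors \<open>h\<close> satisfies
  \<open>T Y \<subseteq> Y + span {e}\<close>. If the parameters \<open>l\<close> grow fast enough, they are the zeros of an entire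
  function \<open>F\<close> whose coefficients decay fast enough that each \<open>z ^ k * F\<close> defines a bounded
  functional, via \<open>z ^ n \<mapsto> g n\<close>. All these functionals vanish on \<open>Y\<close>, so \<open>Y\<close> has infinite codimension.
\<close>

section \<open>Closures and closedness of spans in complex normed spaces\<close>

lemma bounded_linear_scaleC: "bounded_linear (\<lambda>x :: 'a :: complex_normed_vector. c *C x)"
proof (rule bounded_linear_intro[where K = "cmod c"])
  show "c *C (r *\<^sub>R x) = r *\<^sub>R (c *C x)" for r and x :: 'a
    by (simp add: scaleR_scaleC scaleC_scaleC mult.commute)
qed (simp_all add: scaleC_add_right norm_scaleC mult.commute)

lemma csubspace_closure:
  fixes S :: "'a :: complex_normed_vector set"
  assumes "csubspace S"
  shows "csubspace (closure S)"
proof (rule complex_vector.subspaceI)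
  show "0 \<in> closure S"
    using complex_vector.subspace_0[OF assms] closure_subset by blast
next
  fix x y assume "x \<in> closure S" "y \<in> closure S"
  then obtain f g where "\<forall>n. f n \<in> S" "f \<longlonglongrightarrow> x" "\<forall>n. g n \<in> S" "g \<longlonglongrightarrow> y"
    unfolding closure_sequential by blast
  then have "\<forall>n. f n + g n \<in> S" "(\<lambda>n. f n + g n) \<longlonglongrightarrow> x + y"
    using complex_vector.subspace_add[OF assms] by (auto intro: tendsto_add)
  then show "x + y \<in> closure S"
    unfolding closure_sequential by (intro exI[of _ "\<lambda>n. f n + g n"]) auto
next
  fix c x assume "x \<in> closure S"
  then obtain f where "\<forall>n. f n \<in> S" "f \<longlonglongrightarrow> x"
    unfolding closure_sequential by blast
  then have "\<forall>n. c *C f n \<in> S" "(\<lambda>n. c *C f n) \<longlonglongrightarrow> c *C x"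
    using complex_vector.subspace_scale[OF assms]
    by (auto intro: bounded_linear.tendsto[OF bounded_linear_scaleC])
  then show "c *C x \<in> closure S"
    unfolding closure_sequential by (intro exI[of _ "\<lambda>n. c *C f n"]) auto
qed

text \<open>Some ball of radius \<open>d\<close> about \<open>b\<close> misses \<open>W\<close>.
  Dividing \<open>x - k *C b\<close> by \<open>- k\<close> shows that \<open>b - x / k\<close> lies
  in \<open>W\<close>, hence has distance at least \<open>d\<close> from \<open>b\<close>. So the
  coefficient of \<open>b\<close> modulo \<open>W\<close> depends continuously on the
  vector.\<close>

lemma coefficient_bound:
  fixes b :: "'a :: complex_normed_vector"
  assumes "closed W" "csubspace W" "b \<notin> W"
  shows "\<exists>d>0. \<forall>x k. x - k *C b \<in> W \<longrightarrow> d * cmod k \<le> norm x"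
proof -
  obtain d where d: "d > 0" "ball b d \<subseteq> - W"
    using assms(1,3) open_contains_ball[of "- W"] by blast
  have "d * cmod k \<le> norm x" if "x - k *C b \<in> W" for x k
  proof (cases "k = 0")
    case False
    have "(- inverse k) *C (x - k *C b) \<in> W"
      using complex_vector.subspace_scale[OF assms(2) that] .
    moreover have "(- inverse k) *C (x - k *C b) = b - inverse k *C x"
      using False by (simp add: complex_vector.scale_right_diff_distrib scaleC_scaleC scaleC_one)
    ultimately have "d \<le> dist b (b - inverse k *C x)"
      using d(2) by (metis ComplD in_mono mem_ball not_le)
    then have "d \<le> norm x / cmod k"
      by (simp add: dist_norm norm_scaleC norm_inverse divide_inverse mult.commute)
    then show ?thesis
      using False by (simp add: field_simps)
  qed simp
  with d(1) show ?thesis by blast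
qed

text \<open>By \<open>coefficient_bound\<close>, a convergent sequence in the larger span has Cauchy
  coefficients along \<open>b\<close>. Subtracting \<open>b\<close> times these coefficients leaves
  a convergent sequence in the closed span of \<open>S\<close>.\<close>

lemma closed_cspan_insert:
  fixes b :: "'a :: complex_banach"
  assumes "closed (cspan S)"
  shows "closed (cspan (insert b S))"
proof (cases "b \<in> cspan S")
  case True
  then show ?thesis using assms by (simp add: complex_vector.span_redundant)
next
  case False
  obtain d where d: "d > 0" "\<And>x k. x - k *C b \<in> cspan S \<Longrightarrow> d * cmod k \<le> norm x"
    using coefficient_bound[OF assms complex_vector.subspace_span False] by blast
  show ?thesis
    unfolding closed_sequential_limits
  proof (intro allI impI, elim conjE)
    fix f l assume f: "\<forall>n. f n \<in> cspan (insert b S)" "f \<longlonglongrightarrow> l"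
    then have "\<forall>n. \<exists>k. f n - k *C b \<in> cspan S"
      by (simp add: complex_vector.span_insert)
    then obtain k where k: "\<And>n. f n - k n *C b \<in> cspan S" by metis
    have "Cauchy k"
      unfolding Cauchy_iff
    proof (intro allI impI)
      fix e :: real assume "e > 0"
      then have "e * d > 0" using d(1) by simp
      moreover have "Cauchy f" using f(2) by (rule LIMSEQ_imp_Cauchy)
      ultimately obtain M where M: "\<And>m n. m \<ge> M \<Longrightarrow> n \<ge> M \<Longrightarrow> norm (f m - f n) < e * d"
        unfolding Cauchy_iff by metis
      have "norm (k m - k n) < e" if "m \<ge> M" "n \<ge> M" for m n
      proof -
        have "(f m - k m *C b) - (f n - k n *C b) \<in> cspan S"
          by (intro complex_vector.span_diff k)
        then have "(f m - f n) - (k m - k n) *C b \<in> cspan S"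
          by (simp add: complex_vector.scale_left_diff_distrib algebra_simps)
        from d(2)[OF this] M[OF that] have "d * cmod (k m - k n) < e * d" by linarith
        then show ?thesis using d(1) by (simp add: mult.commute)
      qed
      then show "\<exists>M. \<forall>m\<ge>M. \<forall>n\<ge>M. norm (k m - k n) < e" by blast
    qed
    then obtain c where c: "k \<longlonglongrightarrow> c"
      using Cauchy_convergent convergent_def by blast
    have "(\<lambda>n. (k n - c) *C b) \<longlonglongrightarrow> 0"
    proof (rule tendsto_norm_zero_cancel)
      have "(\<lambda>n. cmod (k n - c) * norm b) \<longlonglongrightarrow> 0 * norm b"
        using c by (intro tendsto_mult tendsto_const tendsto_norm_zero)
          (simp add: LIM_zero_iff)
      then show "(\<lambda>n. norm ((k n - c) *C b)) \<longlonglongrightarrow> 0"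
        by (simp add: norm_scaleC)
    qed
    then have "(\<lambda>n. f n - c *C b - (k n - c) *C b) \<longlonglongrightarrow> l - c *C b - 0"
      using f(2) by (intro tendsto_diff tendsto_const)
    then have "(\<lambda>n. f n - k n *C b) \<longlonglongrightarrow> l - c *C b"
      by (simp add: complex_vector.scale_left_diff_distrib)
    then have "l - c *C b \<in> cspan S"
      by (rule closed_sequentially[OF assms k])
    then show "l \<in> cspan (insert b S)"
      by (auto simp: complex_vector.span_insert)
  qed
qed

section \<open>Bounded linear functionals vanishing on a subspace of finite codimension\<close>

definition bounded_functional :: "('a :: complex_normed_vector \<Rightarrow> complex) \<Rightarrow> real \<Rightarrow> bool"
  where "bounded_functional g K \<longleftrightarrow>
    (\<forall>x y. g (x + y) = g x + g y) \<and> (\<forall>c x. g (c *C x) = c * g x) \<and>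
    (\<forall>x. cmod (g x) \<le> K * norm x)"

lemma bounded_functional_sum:
  assumes "bounded_functional g K"
  shows "g (\<Sum>i\<in>I. a i *C v i) = (\<Sum>i\<in>I. a i * g (v i))"
proof -
  have lin: "g (x + y) = g x + g y" "g (c *C x) = c * g x" for x y c
    using assms by (auto simp: bounded_functional_def)
  show ?thesis
    by (induction I rule: infinite_finite_induct) (use lin lin(2)[of 0 0] in auto)
qed

lemma bounded_functional_add: "bounded_functional g K \<Longrightarrow> g (x + y) = g x + g y"
  and bounded_functional_scale: "bounded_functional g K \<Longrightarrow> g (c *C x) = c * g x"
  and bounded_functional_bound: "bounded_functional g K \<Longrightarrow> cmod (g x) \<le> K * norm x"
  by (auto simp: bounded_functional_def)

lemma bounded_functional_zero: "bounded_functional g K \<Longrightarrow> g 0 = 0"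
  using bounded_functional_scale[of g K 0 0] by simp

lemma bounded_functional_kernel:
  assumes "bounded_functional g K"
  shows "closed {x. g x = 0}" "csubspace {x. g x = 0}"
proof -
  have "bounded_linear g"
    using assms by (intro bounded_linear_intro[where K = K])
      (auto simp: bounded_functional_def scaleR_scaleC mult.commute scaleR_conv_of_real)
  then show "closed {x. g x = 0}"
    by (intro closed_Collect_eq linear_continuous_on continuous_on_const)
  show "csubspace {x. g x = 0}"
    using assms bounded_functional_zero[OF assms]
    by (auto intro!: complex_vector.subspaceI simp: bounded_functional_add bounded_functional_scale)
qed

text \<open>A linear functional that vanishes on \<open>W\<close> stays bounded when finitely many
  vectors are added to \<open>W\<close> one at a time. Closedness is carried through the induction
  because \<open>coefficient_bound\<close> needs it at each step.\<close>

lemma bounded_functional_bounded_on_span: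
  fixes W :: "'a :: complex_banach set"
  assumes W: "closed W" "csubspace W"
    and add: "\<And>x y. g (x + y) = g x + g y" and scale: "\<And>c x. g (c *C x) = c * g x"
    and zero: "\<And>x. x \<in> W \<Longrightarrow> g x = 0"
    and "finite B"
  shows "closed (cspan (W \<union> B)) \<and> (\<exists>K\<ge>0. \<forall>x\<in>cspan (W \<union> B). cmod (g x) \<le> K * norm x)"
  using \<open>finite B\<close>
proof (induction B rule: finite_induct)
  case empty
  have "cspan W = W" using W(2) by simp
  then have "closed (cspan (W \<union> {}))" "\<forall>x\<in>cspan (W \<union> {}). cmod (g x) \<le> 0 * norm x"
    using W(1) zero by (metis Un_empty_right, metis Un_empty_right mult_zero_left norm_zero order_refl)
  then show ?case by blast
next
  case (insert b B)
  let ?S = "cspan (W \<union> B)"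
  obtain K where cl: "closed ?S" and K: "K \<ge> 0" "\<And>x. x \<in> ?S \<Longrightarrow> cmod (g x) \<le> K * norm x"
    using insert.IH by blast
  have un: "W \<union> insert b B = insert b (W \<union> B)" by simp
  have "\<exists>K\<ge>0. \<forall>x\<in>cspan (insert b (W \<union> B)). cmod (g x) \<le> K * norm x"
  proof (cases "b \<in> ?S")
    case True
    then show ?thesis using K by (auto simp: complex_vector.span_redundant)
  next
    case False
    obtain d where d: "d > 0" "\<And>x k. x - k *C b \<in> ?S \<Longrightarrow> d * cmod k \<le> norm x"
      using coefficient_bound[OF cl complex_vector.subspace_span False] by blast
    \<comment> \<open>This constant comes from splitting \<open>x\<close> as
      \<open>(x - k *C b) + k *C b\<close> and using \<open>cmod k \<le> norm x / d\<close>.\<close>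
    define L where "L = K + (K * norm b + cmod (g b)) / d"
    have "cmod (g x) \<le> L * norm x" if "x \<in> cspan (insert b (W \<union> B))" for x
    proof -
      obtain k where k: "x - k *C b \<in> ?S"
        using \<open>x \<in> cspan (insert b (W \<union> B))\<close> by (auto simp: complex_vector.span_insert)
      have kle: "cmod k \<le> norm x / d"
        using d(2)[OF k] d(1) by (simp add: field_simps)
      have "g x = g (x - k *C b) + k * g b"
        using add[of "x - k *C b" "k *C b"] scale by simp
      then have "cmod (g x) \<le> cmod (g (x - k *C b)) + cmod k * cmod (g b)"
        by (metis norm_mult norm_triangle_ineq)
      also have "\<dots> \<le> K * (norm x + cmod k * norm b) + cmod k * cmod (g b)"
        using K(2)[OF k] mult_left_mono[OF norm_triangle_ineq4[of x "k *C b"] K(1)]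
        by (simp add: norm_scaleC)
      also have "\<dots> = K * norm x + cmod k * (K * norm b + cmod (g b))"
        by (simp add: algebra_simps)
      also have "\<dots> \<le> K * norm x + (norm x / d) * (K * norm b + cmod (g b))"
        using kle K(1) by (intro add_left_mono mult_right_mono) auto
      also have "\<dots> = L * norm x"
        by (simp add: L_def algebra_simps add_divide_distrib)
      finally show ?thesis .
    qed
    moreover have "L \<ge> 0" using K(1) d(1) by (simp add: L_def)
    ultimately show ?thesis by blast
  qed
  then show ?case using closed_cspan_insert[OF cl] un by metis
qed

text \<open>Purely algebraic: a basis of \<open>U\<close> together with \<open>v\<close> is
  independent, so values on it can be prescribed. Continuity is supplied separately.\<close>

lemma functional_separating_subspace:
  fixes v :: "'a :: complex_normed_vector"
  assumes "csubspace U" "v \<notin> U"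
  shows "\<exists>g :: 'a \<Rightarrow> complex. (\<forall>x y. g (x + y) = g x + g y) \<and>
    (\<forall>c x. g (c *C x) = c * g x) \<and> (\<forall>x\<in>U. g x = 0) \<and> g v = 1"
proof -
  interpret p: vector_space_pair "scaleC :: complex \<Rightarrow> 'a \<Rightarrow> 'a" "(*) :: complex \<Rightarrow> complex \<Rightarrow> complex"
    by unfold_locales (simp_all add: algebra_simps)
  obtain B where B: "B \<subseteq> U" "\<not> complex_vector.dependent B" "U \<subseteq> cspan B"
    using complex_vector.maximal_independent_subset[of U] by blast
  have "cspan B \<subseteq> U"
    using B(1) assms(1) by (rule complex_vector.span_minimal)
  then have v: "v \<notin> cspan B" using assms(2) by blast
  then have "\<not> complex_vector.dependent (insert v B)"
    using B(2) complex_vector.independent_insertI by blast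
  from p.linear_independent_extend[OF this, of "\<lambda>x. if x = v then 1 else 0"]
  obtain g where g: "Vector_Spaces.linear scaleC (*) g"
    "\<And>x. x \<in> insert v B \<Longrightarrow> g x = (if x = v then 1 else 0)"
    by blast
  have "v \<notin> B" using v complex_vector.span_base by blast
  then have "B \<subseteq> {x. g x = 0}" using g(2) by auto
  moreover have lin: "g (x + y) = g x + g y" "g (c *C x) = c * g x" for x y c
    using p.linear_add[OF g(1)] p.linear_scale[OF g(1)] by auto
  moreover have "csubspace {x. g x = 0}"
    using lin p.linear_0[OF g(1)] by (auto intro!: complex_vector.subspaceI)
  ultimately have "cspan B \<subseteq> {x. g x = 0}"
    by (intro complex_vector.span_minimal)
  then have "\<forall>x\<in>U. g x = 0" using B(3) by blast
  then show ?thesis using g(2)[of v] lin by auto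
qed

text \<open>Boundedness comes from the finite codimension of \<open>W\<close> instead of the
  Hahn-Banach theorem: \<open>W\<close> and \<open>B\<close> together span the whole space.\<close>

lemma bounded_functional_separating:
  fixes v :: "'a :: complex_banach"
  assumes "csubspace U" "v \<notin> U" and W: "closed W" "csubspace W" "W \<subseteq> U"
    and B: "finite B" "\<And>x. \<exists>b\<in>cspan B. x - b \<in> W"
  shows "\<exists>g K. bounded_functional g K \<and> (\<forall>x\<in>U. g x = 0) \<and> g v = 1"
proof -
  obtain g :: "'a \<Rightarrow> complex" where g: "\<And>x y. g (x + y) = g x + g y" "\<And>c x. g (c *C x) = c * g x"
    "\<And>x. x \<in> U \<Longrightarrow> g x = 0" "g v = 1"
    using functional_separating_subspace[OF assms(1,2)] by metis
  have "x \<in> cspan (W \<union> B)" for x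
  proof -
    obtain b where b: "b \<in> cspan B" "x - b \<in> W" using B(2) by blast
    have "b \<in> cspan (W \<union> B)" "x - b \<in> cspan (W \<union> B)"
      using b complex_vector.span_mono[of B "W \<union> B"] complex_vector.span_base by blast+
    then show ?thesis using complex_vector.span_add by fastforce
  qed
  moreover have "\<exists>K\<ge>0. \<forall>x\<in>cspan (W \<union> B). cmod (g x) \<le> K * norm x"
    using bounded_functional_bounded_on_span[OF W(1,2) g(1,2) _ B(1)] g(3) W(3) by blast
  ultimately show ?thesis
    using g unfolding bounded_functional_def by blast
qed

section \<open>Linear dependence modulo a subspace of finite codimension\<close>

lemma finite_cdim_quotient_representatives:
  fixes Y :: "'a :: complex_normed_vector set"
  assumes "finite_cdim_quotient Y" "csubspace Y"
  shows "\<exists>B. finite B \<and> (\<forall>x. \<exists>b\<in>cspan B. x - b \<in> Y)"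
proof -
  obtain B where B: "finite B" "coset Y ` cspan B = range (coset Y)"
    using assms(1) unfolding finite_cdim_quotient_def by blast
  have "\<exists>b\<in>cspan B. x - b \<in> Y" for x
  proof -
    obtain b where b: "b \<in> cspan B" "coset Y x = coset Y b"
      using B(2) by blast
    have "x + 0 \<in> coset Y x"
      unfolding coset_def using complex_vector.subspace_0[OF assms(2)] by blast
    then have "x \<in> coset Y b" using b(2) by simp
    then show ?thesis using b(1) unfolding coset_def by (auto intro!: bexI[of _ b])
  qed
  with B(1) show ?thesis by blast
qed

text \<open>Dependence is a property of sets, but a relation for an indexed family is wanted. A
  repeated value gives the relation \<open>v i - v j = 0\<close>; otherwise the
  \<open>card B + 1\<close> values are too many to be independent.\<close>

lemma finite_family_dependent_span:
  fixes v :: "nat \<Rightarrow> 'a :: complex_normed_vector"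
  assumes "finite B" "\<And>i. v i \<in> cspan B"
  shows "\<exists>a. (\<exists>k\<le>card B. a k \<noteq> 0) \<and> (\<Sum>i\<le>card B. a i *C v i) = 0"
proof (cases "inj_on v {..card B}")
  case True
  have "complex_vector.dependent (v ` {..card B})"
  proof (rule ccontr)
    assume "\<not> complex_vector.dependent (v ` {..card B})"
    then have "card (v ` {..card B}) \<le> card B"
      using complex_vector.independent_span_bound[OF assms(1)] assms(2) by blast
    then show False using card_image[OF True] by simp
  qed
  then obtain u where u: "\<exists>x\<in>v ` {..card B}. u x \<noteq> 0" "(\<Sum>x\<in>v ` {..card B}. u x *C x) = 0"
    using complex_vector.dependent_finite[of "v ` {..card B}"] by auto
  then show ?thesis
    by (intro exI[of _ "u \<circ> v"]) (auto simp: sum.reindex[OF True])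
next
  case False
  then obtain i j where ij: "i \<le> card B" "j \<le> card B" "i \<noteq> j" "v i = v j"
    by (auto simp: inj_on_def)
  define a :: "nat \<Rightarrow> complex" where "a k = (if k = i then 1 else 0) - (if k = j then 1 else 0)" for k
  have "(\<Sum>k\<le>card B. a k *C v k) = (\<Sum>k\<le>card B. (if k = i then v i else 0) - (if k = j then v j else 0))"
    by (rule sum.cong) (auto simp: a_def scaleC_one complex_vector.scale_left_diff_distrib)
  also have "\<dots> = 0"
    using ij by (simp add: sum_subtractf)
  finally have "(\<Sum>k\<le>card B. a k *C v k) = 0" .
  moreover have "a i \<noteq> 0" using ij by (simp add: a_def)
  ultimately show ?thesis using ij(1) by blast
qed

text \<open>A relation between representatives in the span of \<open>B\<close> is a relation modulo
  \<open>W\<close>. It is cut at its largest index with nonzero coefficient, so that it has a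
  leading term; later arguments use this term as the degree of a polynomial or isolate it.\<close>

lemma finite_family_dependent:
  fixes v :: "nat \<Rightarrow> 'a :: complex_normed_vector"
  assumes W: "csubspace W" and B: "finite B" "\<And>i. \<exists>b\<in>cspan B. v i - b \<in> W"
  shows "\<exists>a k. k \<le> card B \<and> a k \<noteq> 0 \<and> (\<Sum>i\<le>k. a i *C v i) \<in> W"
proof -
  obtain b where b: "\<And>i. b i \<in> cspan B" "\<And>i. v i - b i \<in> W"
    using B(2) by metis
  obtain a where a: "\<exists>k\<le>card B. a k \<noteq> 0" "(\<Sum>i\<le>card B. a i *C b i) = 0"
    using finite_family_dependent_span[of B b, OF B(1) b(1)] by (elim exE conjE) (rule that, iprover+)
  define A where "A = {k. k \<le> card B \<and> a k \<noteq> 0}"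
  have "finite A" "A \<noteq> {}" using a(1) by (auto simp: A_def)
  then have M: "Max A \<in> A" "\<And>k. k \<in> A \<Longrightarrow> k \<le> Max A" by auto
  have "(\<Sum>i\<le>card B. a i *C (v i - b i)) \<in> W"
    by (intro complex_vector.subspace_sum[OF W] complex_vector.subspace_scale[OF W] b(2))
  then have "(\<Sum>i\<le>card B. a i *C v i) \<in> W"
    using a(2) by (simp add: complex_vector.scale_right_diff_distrib sum_subtractf)
  also have "(\<Sum>i\<le>card B. a i *C v i) = (\<Sum>i\<le>Max A. a i *C v i)"
  proof (rule sum.mono_neutral_right)
    show "\<forall>i\<in>{..card B} - {..Max A}. a i *C v i = 0"
      using M(2) unfolding A_def by fastforce
  qed (use M(1) in \<open>auto simp: A_def\<close>)
  finally show ?thesis using M(1) by (auto simp: A_def)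
qed

text \<open>If \<open>k\<close> is the leading index of a relation modulo \<open>W\<close>, then
  \<open>g k\<close> annihilates all of it except the leading term. This is the test for infinite
  dimension (with \<open>W = {0}\<close>) and for infinite codimension.\<close>

lemma no_triangular_family:
  fixes v :: "nat \<Rightarrow> 'a :: complex_normed_vector" and g :: "nat \<Rightarrow> 'a \<Rightarrow> complex"
  assumes W: "csubspace W" and B: "finite B" "\<And>i. \<exists>b\<in>cspan B. v i - b \<in> W"
    and g: "\<And>k. bounded_functional (g k) (K k)"
    and zero: "\<And>k x. x \<in> W \<Longrightarrow> g k x = 0"
    and lower: "\<And>i k. i < k \<Longrightarrow> g k (v i) = 0" and diag: "\<And>k. g k (v k) \<noteq> 0"
  shows False
proof -
  obtain a k where a: "a k \<noteq> 0" "(\<Sum>i\<le>k. a i *C v i) \<in> W"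
    using finite_family_dependent[of W B v, OF W B] by (elim exE conjE) (rule that)
  have "(\<Sum>i\<le>k. a i * g k (v i)) = 0"
    using zero[OF a(2)] bounded_functional_sum[OF g] by metis
  also have "(\<Sum>i\<le>k. a i * g k (v i)) = a k * g k (v k)"
    by (subst sum.remove[of _ k]) (auto intro!: sum.neutral lower)
  finally show False using a(1) diag by simp
qed

section \<open>Polynomials in a linear map and nilpotency modulo an invariant subspace\<close>

locale endomorphism =
  fixes T :: "'a :: complex_normed_vector \<Rightarrow> 'a"
  assumes add: "T (x + y) = T x + T y" and scale: "T (c *C x) = c *C T x"
begin

lemma zero: "T 0 = 0"
  using scale[of 0 0] by simp

lemma sum: "T (\<Sum>i\<in>I. f i) = (\<Sum>i\<in>I. T (f i))"
  by (induction I rule: infinite_finite_induct) (simp_all add: add zero)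

lemma funpow_plus: "(T ^^ n) (x + y) = (T ^^ n) x + (T ^^ n) y"
  by (induction n) (simp_all add: add)

lemma funpow_scale: "(T ^^ n) (c *C x) = c *C (T ^^ n) x"
  by (induction n) (simp_all add: scale)

lemma funpow_sum: "(T ^^ n) (\<Sum>i\<in>I. f i) = (\<Sum>i\<in>I. (T ^^ n) (f i))"
  by (induction n) (simp_all add: sum)

lemma funpow_invariant:
  assumes "T ` W \<subseteq> W" "x \<in> W" shows "(T ^^ n) x \<in> W"
  using assms by (induction n) auto

definition poly_op :: "complex poly \<Rightarrow> 'a \<Rightarrow> 'a"
  where "poly_op p x = (\<Sum>i\<le>degree p. coeff p i *C (T ^^ i) x)"

lemma poly_op_altdef:
  assumes "degree p \<le> n"
  shows "poly_op p x = (\<Sum>i\<le>n. coeff p i *C (T ^^ i) x)"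
  unfolding poly_op_def using assms
  by (intro sum.mono_neutral_left) (auto simp: coeff_eq_0)

lemma poly_op_commute: "poly_op p (T x) = T (poly_op p x)"
  by (simp add: poly_op_def sum scale funpow_swap1[of T])

lemma poly_op_linear_factor:
  "poly_op ([:- a, 1:] * q) x = T (poly_op q x) - a *C poly_op q x"
proof -
  let ?n = "degree q"
  have "degree ([:- a, 1:] * q) \<le> Suc ?n"
    by (rule order_trans[OF degree_mult_le]) simp
  then have "poly_op ([:- a, 1:] * q) x = (\<Sum>i\<le>Suc ?n. coeff ([:- a, 1:] * q) i *C (T ^^ i) x)"
    by (rule poly_op_altdef)
  \<comment> \<open>Multiplying \<open>q\<close> by the linear factor gives the shifted polynomial
    \<open>pCons 0 q\<close> minus \<open>a\<close> times \<open>q\<close>.\<close>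
  also have "\<dots> = (\<Sum>i\<le>Suc ?n. coeff (pCons 0 q) i *C (T ^^ i) x)
      - (\<Sum>i\<le>Suc ?n. a *C (coeff q i *C (T ^^ i) x))"
    unfolding sum_subtractf[symmetric]
    by (rule sum.cong)
      (simp_all add: complex_vector.scale_left_diff_distrib scaleC_scaleC)
  also have "(\<Sum>i\<le>Suc ?n. coeff (pCons 0 q) i *C (T ^^ i) x) = T (poly_op q x)"
    unfolding sum.atMost_Suc_shift by (simp add: poly_op_def sum scale del: sum.atMost_Suc)
  also have "(\<Sum>i\<le>Suc ?n. a *C (coeff q i *C (T ^^ i) x)) = a *C poly_op q x"
    by (simp add: poly_op_altdef[of q "Suc ?n"] complex_vector.scale_sum_right
        del: sum.atMost_Suc)
  finally show ?thesis .
qed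

text \<open>Linear factors are split off one by one. A factor with root \<open>a \<noteq> 0\<close>
  can be cancelled, since \<open>T - a\<close> is injective modulo \<open>W\<close>, and the lost
  degree is restored by invariance of \<open>W\<close>; a factor with root 0 is \<open>T\<close>
  itself.\<close>

lemma funpow_degree_mem:
  assumes W: "csubspace W" "T ` W \<subseteq> W"
    and inj: "\<And>a y. a \<noteq> 0 \<Longrightarrow> T y - a *C y \<in> W \<Longrightarrow> y \<in> W"
  shows "p \<noteq> 0 \<Longrightarrow> poly_op p x \<in> W \<Longrightarrow> (T ^^ degree p) x \<in> W"
proof (induction "degree p" arbitrary: p x)
  case 0
  then obtain c where p: "p = [:c:]" "c \<noteq> 0"
    by (metis degree_eq_zeroE pCons_0_0)
  then have "c *C x \<in> W"
    using 0 by (simp add: poly_op_def)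
  then have "inverse c *C (c *C x) \<in> W"
    by (rule complex_vector.subspace_scale[OF W(1)])
  then show ?case using p by (simp add: scaleC_scaleC scaleC_one)
next
  case (Suc n)
  then obtain a where "poly p a = 0"
    using fundamental_theorem_of_algebra[of p] constant_degree[of p] by auto
  then obtain q where q: "p = [:- a, 1:] * q"
    by (auto simp: poly_eq_0_iff_dvd dvd_def)
  with Suc.prems have q0: "q \<noteq> 0" by auto
  then have deg: "degree q = n"
    using Suc.hyps(2) unfolding q by (subst (asm) degree_mult_eq) auto
  have *: "T (poly_op q x) - a *C poly_op q x \<in> W"
    using Suc.prems(2) by (simp add: q poly_op_linear_factor del: mult_pCons_left)
  show ?case
  proof (cases "a = 0")
    case True
    then have "poly_op q (T x) \<in> W" using * by (simp add: poly_op_commute)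
    then have "(T ^^ n) (T x) \<in> W" using Suc.hyps(1)[OF deg[symmetric] q0] deg by simp
    then show ?thesis using Suc.hyps(2) by (simp add: funpow_swap1 flip: Suc.hyps(2))
  next
    case False
    have "poly_op q x \<in> W" using inj[OF False *] .
    then have "(T ^^ n) x \<in> W" using Suc.hyps(1)[OF deg[symmetric] q0] deg by simp
    then have "T ((T ^^ n) x) \<in> W" using W(2) by blast
    then show ?thesis using Suc.hyps(2) by (simp flip: Suc.hyps(2))
  qed
qed

text \<open>A relation modulo \<open>W\<close> among the first \<open>card B + 1\<close> orbit
  vectors is a nonzero polynomial in \<open>T\<close> sending \<open>x\<close> into
  \<open>W\<close>. Raising its degree to \<open>card B\<close> makes the exponent depend on
  \<open>B\<close> alone.\<close>

lemma nilpotent_modulo: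
  assumes W: "csubspace W" "T ` W \<subseteq> W"
    and inj: "\<And>a y. a \<noteq> 0 \<Longrightarrow> T y - a *C y \<in> W \<Longrightarrow> y \<in> W"
    and B: "finite B" "\<And>i. \<exists>b\<in>cspan B. (T ^^ i) x - b \<in> W"
  shows "(T ^^ card B) x \<in> W"
proof -
  obtain a k where a: "k \<le> card B" "a k \<noteq> 0" "(\<Sum>i\<le>k. a i *C (T ^^ i) x) \<in> W"
    using finite_family_dependent[of W B "\<lambda>i. (T ^^ i) x", OF W(1) B] by (elim exE conjE) (rule that)
  define p where "p = Abs_poly (\<lambda>i. if i \<le> k then a i else 0)"
  have c: "coeff p i = (if i \<le> k then a i else 0)" for i
    unfolding p_def by (subst coeff_Abs_poly[of k]) auto
  have deg: "degree p = k"
    using a(2) c by (intro antisym degree_le le_degree) auto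
  have "poly_op p x \<in> W" using a(3) by (simp add: poly_op_def deg c)
  moreover have "p \<noteq> 0" using a(2) c[of k] by auto
  ultimately have "(T ^^ k) x \<in> W"
    using funpow_degree_mem[OF W] inj deg by blast
  then have "(T ^^ (card B - k)) ((T ^^ k) x) \<in> W"
    by (rule funpow_invariant[OF W(2)])
  then show ?thesis using a(1) by (simp flip: funpow_add comp_apply[of "T ^^ _" "T ^^ _"])
qed

text \<open>If \<open>y \<notin> W\<close>, then \<open>y\<close> and its iterated preimages are independent modulo \<open>W\<close>.\<close>

lemma injective_modulo:
  assumes W: "csubspace W" "T ` W \<subseteq> W" and surj: "surj T"
    and B: "finite B" "\<And>x. \<exists>b\<in>cspan B. x - b \<in> W"
    and y: "T y \<in> W"
  shows "y \<in> W"
proof -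
  define v where "v i = (inv T ^^ i) y" for i
  have Tv: "(T ^^ n) (v (n + i)) = v i" for n i
  proof (induction n)
    case (Suc n)
    have "T (v (Suc n + i)) = v (n + i)"
      by (simp add: v_def surj_f_inv_f[OF surj])
    then show ?case
      unfolding funpow_Suc_right o_apply by (simp only: Suc)
  qed simp
  obtain a k where a: "a k \<noteq> 0" "(\<Sum>i\<le>k. a i *C v i) \<in> W"
    using finite_family_dependent[of W B v, OF W(1) B] by (elim exE conjE) (rule that)
  \<comment> \<open>Applying \<open>T ^^ k\<close> to the relation turns \<open>v k\<close> into
    \<open>y\<close> and each earlier \<open>v i\<close> into an iterate of \<open>T y\<close>,
    which lies in \<open>W\<close>. Only \<open>a k *C y\<close> remains.\<close>
  have "(T ^^ k) (v i) \<in> W" if "i < k" for i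
  proof -
    define j where "j = k - Suc i"
    have k: "k = j + Suc i" using that by (simp add: j_def)
    have "(T ^^ k) (v i) = (T ^^ j) (T ((T ^^ i) (v (i + 0))))"
      unfolding k funpow_add by simp
    also have "\<dots> = (T ^^ j) (T y)"
      unfolding Tv by (simp add: v_def)
    also have "\<dots> \<in> W" using funpow_invariant[OF W(2) y] .
    finally show ?thesis .
  qed
  then have "(\<Sum>i<k. a i *C (T ^^ k) (v i)) \<in> W"
    by (intro complex_vector.subspace_sum[OF W(1)] complex_vector.subspace_scale[OF W(1)]) auto
  moreover have "(T ^^ k) (\<Sum>i\<le>k. a i *C v i) \<in> W"
    using funpow_invariant[OF W(2) a(2)] .
  moreover have "(T ^^ k) (\<Sum>i\<le>k. a i *C v i) = (\<Sum>i<k. a i *C (T ^^ k) (v i)) + a k *C y"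
    using Tv[of k 0]
    by (simp add: funpow_plus funpow_sum funpow_scale v_def flip: lessThan_Suc_atMost)
  ultimately have "a k *C y \<in> W"
    using complex_vector.subspace_diff[OF W(1)] by fastforce
  then have "inverse (a k) *C (a k *C y) \<in> W"
    using complex_vector.subspace_scale[OF W(1)] by blast
  then show ?thesis using a(1) by (simp add: scaleC_scaleC scaleC_one)
qed

end

context endomorphism
begin

text \<open>With \<open>W = {0}\<close>, the previous results make \<open>T\<close> nilpotent on
  \<open>Y\<close>. The hypothesis on eigenvectors includes the eigenvalue 0, so powers of
  \<open>T\<close> kill no nonzero vector.\<close>

lemma finite_dimensional_invariant_trivial:
  assumes eig: "\<And>a y. T y = a *C y \<Longrightarrow> y = 0"
    and Y: "finite_cdim Y" "T ` Y \<subseteq> Y" "y \<in> Y"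
  shows "y = 0"
proof -
  obtain B where B: "finite B" "cspan B = Y"
    using Y(1) unfolding finite_cdim_def by blast
  have "(T ^^ card B) y \<in> {0}"
  proof (rule nilpotent_modulo)
    show "T ` {0} \<subseteq> {0}" by (simp add: zero)
    show "\<exists>b\<in>cspan B. (T ^^ i) y - b \<in> {0}" for i
      using funpow_invariant[OF Y(2,3)] B(2) by (intro bexI[of _ "(T ^^ i) y"]) auto
  qed (use eig B in \<open>auto simp: complex_vector.subspace_def\<close>)
  moreover have "(T ^^ n) y = 0 \<Longrightarrow> y = 0" for n
  proof (induction n)
    case (Suc n)
    then have "T ((T ^^ n) y) = 0 *C (T ^^ n) y" by simp
    then show ?case using eig Suc.IH by blast
  qed simp
  ultimately show ?thesis by blast
qed

text \<open>Surjectivity of \<open>T - a\<close> on the whole space gives injectivity modulo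
  \<open>W\<close>, by \<open>injective_modulo\<close> applied to \<open>T - a\<close>. The exponent
  \<open>card B\<close> serves all \<open>x\<close> at once.\<close>

lemma uniformly_nilpotent_modulo:
  assumes W: "csubspace W" "T ` W \<subseteq> W"
    and surj: "\<And>a. a \<noteq> 0 \<Longrightarrow> surj (\<lambda>x. T x - a *C x)"
    and B: "finite B" "\<And>x. \<exists>b\<in>cspan B. x - b \<in> W"
  shows "\<exists>M. \<forall>x. (T ^^ M) x \<in> W"
proof (intro exI allI)
  fix x
  show "(T ^^ card B) x \<in> W"
  proof (rule nilpotent_modulo[OF W])
    fix a y assume a: "a \<noteq> 0" "T y - a *C y \<in> W"
    interpret S: endomorphism "\<lambda>x. T x - a *C x"
      by unfold_locales (simp_all add: add scale scaleC_add_right scaleC_scaleC mult.commute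
          complex_vector.scale_right_diff_distrib)
    have "(\<lambda>x. T x - a *C x) ` W \<subseteq> W"
      using W complex_vector.subspace_diff complex_vector.subspace_scale by blast
    from S.injective_modulo[OF W(1) this surj[OF a(1)] B a(2)] show "y \<in> W" .
  qed (use B in auto)
qed

section \<open>Resolvent vectors and functionals biorthogonal to an orbit\<close>

text \<open>A Neumann series with remainder, obtained by iterating the equation for
  \<open>h\<close>; it involves no convergence.\<close>

lemma resolvent_expansion:
  assumes "h = l *C e + l *C T h"
  shows "h = (\<Sum>i<M. l ^ Suc i *C (T ^^ i) e) + l ^ M *C (T ^^ M) h"
proof (induction M)
  case (Suc M)
  have "(T ^^ M) h = (T ^^ M) (l *C e + l *C T h)"
    using assms by metis
  also have "\<dots> = l *C (T ^^ M) e + l *C (T ^^ Suc M) h"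
    by (simp add: funpow_plus funpow_scale funpow_swap1[of T])
  finally have "l ^ M *C (T ^^ M) h = l ^ Suc M *C (T ^^ M) e + l ^ Suc M *C (T ^^ Suc M) h"
    by (simp only: scaleC_add_right scaleC_scaleC power_Suc2)
  then show ?case using Suc by (simp only: sum.lessThan_Suc add.assoc)
qed (simp add: scaleC_one)

end

text \<open>In the expansion of \<open>h\<close> the functional kills the remainder, because it
  vanishes on the range of \<open>T ^^ M\<close>, and it keeps only the term with index
  \<open>n\<close>.\<close>

lemma functional_at_resolvent:
  assumes T: "endomorphism T" and g: "bounded_functional g K"
    and delta: "\<And>i. g ((T ^^ i) e) = (if i = n then 1 else 0)"
    and nil: "\<And>x. g ((T ^^ M) x) = 0"
    and h: "h = l *C e + l *C T h"
  shows "g h = l ^ Suc n"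
proof -
  interpret endomorphism T by fact
  \<comment> \<open>At least \<open>M\<close>, to kill the remainder, and more than
    \<open>n\<close>, so that the term with index \<open>n\<close> occurs in the sum.\<close>
  define N where "N = max M (Suc n)"
  have "(T ^^ N) h = (T ^^ M) ((T ^^ (N - M)) h)"
    using funpow_add[of M "N - M" T] by (simp add: N_def)
  then have "g ((T ^^ N) h) = 0" using nil by simp
  moreover have "g h = g ((\<Sum>i<N. l ^ Suc i *C (T ^^ i) e) + l ^ N *C (T ^^ N) h)"
    using resolvent_expansion[OF h, of N] by (rule arg_cong)
  ultimately have "g h = (\<Sum>i<N. l ^ Suc i * g ((T ^^ i) e))"
    by (simp only: bounded_functional_add[OF g] bounded_functional_scale[OF g]
        bounded_functional_sum[OF g]) simp
  also have "\<dots> = (\<Sum>i<N. if i = n then l ^ Suc i else 0)"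
    by (rule sum.cong) (auto simp: delta)
  also have "\<dots> = l ^ Suc n"
    by (subst sum.delta) (simp_all add: N_def)
  finally show ?thesis .
qed

text \<open>Up to the first power that takes \<open>e\<close> into \<open>W\<close>, the orbit is
  independent modulo \<open>W\<close>; afterwards it stays in \<open>W\<close>. So
  \<open>T ^^ n\<close> applied to \<open>e\<close> can be separated from \<open>W\<close> and the
  other orbit vectors. Vanishing on \<open>W\<close> makes the functional vanish on the range of
  \<open>T ^^ M\<close>.\<close>

lemma biorthogonal_functional:
  fixes T :: "'a :: complex_banach \<Rightarrow> 'a"
  assumes T: "endomorphism T"
    and W: "closed W" "csubspace W" "T ` W \<subseteq> W"
    and B: "finite B" "\<And>x. \<exists>b\<in>cspan B. x - b \<in> W"
    and nil: "\<And>x. (T ^^ M) x \<in> W" and e: "(T ^^ n) e \<notin> W"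
  shows "\<exists>g K. bounded_functional g K \<and> (\<forall>i. g ((T ^^ i) e) = (if i = n then 1 else 0)) \<and>
    (\<forall>x. g ((T ^^ M) x) = 0)"
proof -
  interpret endomorphism T by fact
  define m where "m = (LEAST m. (T ^^ m) e \<in> W)"
  have m: "(T ^^ m) e \<in> W" unfolding m_def by (rule LeastI[of _ M]) (rule nil)
  have below: "(T ^^ i) e \<notin> W" if "i < m" for i
    using not_less_Least[of i "\<lambda>m. (T ^^ m) e \<in> W"] that by (simp add: m_def)
  have above: "(T ^^ i) e \<in> W" if "m \<le> i" for i
  proof -
    have "(T ^^ i) e = (T ^^ (i - m)) ((T ^^ m) e)"
      using that funpow_add[of "i - m" m T] by simp
    then show ?thesis using funpow_invariant[OF W(3) m] by simp
  qed
  have nm: "n < m" using e above not_le by blast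
  \<comment> \<open>The sum of \<open>W\<close> and the span of the orbit vectors with index below
    \<open>m\<close> and different from \<open>n\<close>.\<close>
  define U where "U = {x. \<exists>a. a n = 0 \<and> x - (\<Sum>i<m. a i *C (T ^^ i) e) \<in> W}"
  have "csubspace U"
  proof (rule complex_vector.subspaceI)
    show "0 \<in> U"
      unfolding U_def using complex_vector.subspace_0[OF W(2)]
      by (intro CollectI exI[of _ "\<lambda>i. 0"]) simp
  next
    fix x y assume "x \<in> U" "y \<in> U"
    then obtain a b where "a n = 0" "x - (\<Sum>i<m. a i *C (T ^^ i) e) \<in> W"
      "b n = 0" "y - (\<Sum>i<m. b i *C (T ^^ i) e) \<in> W"
      unfolding U_def by auto
    then show "x + y \<in> U"
      unfolding U_def using complex_vector.subspace_add[OF W(2)]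
      by (intro CollectI exI[of _ "\<lambda>i. a i + b i"])
        (auto simp: scaleC_add_left sum.distrib add_diff_add)
  next
    fix c x assume "x \<in> U"
    then obtain a where "a n = 0" "x - (\<Sum>i<m. a i *C (T ^^ i) e) \<in> W"
      unfolding U_def by auto
    moreover from this(2) have "c *C (x - (\<Sum>i<m. a i *C (T ^^ i) e)) \<in> W"
      by (rule complex_vector.subspace_scale[OF W(2)])
    ultimately show "c *C x \<in> U"
      unfolding U_def by (intro CollectI exI[of _ "\<lambda>i. c * a i"])
        (auto simp: complex_vector.scale_right_diff_distrib complex_vector.scale_sum_right scaleC_scaleC)
  qed
  moreover have WU: "W \<subseteq> U"
    unfolding U_def by (intro subsetI CollectI exI[of _ "\<lambda>i. 0"]) simp
  moreover have "(T ^^ n) e \<notin> U"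
  proof
    assume "(T ^^ n) e \<in> U"
    then obtain a where a: "a n = 0" "(T ^^ n) e - (\<Sum>i<m. a i *C (T ^^ i) e) \<in> W"
      unfolding U_def by auto
    define c where "c i = (if i = n then 1 else - a i)" for i
    have "(\<Sum>i<m. c i *C (T ^^ i) e) = (\<Sum>i<m. (if i = n then (T ^^ n) e else 0) - a i *C (T ^^ i) e)"
      by (rule sum.cong) (use a(1) in \<open>auto simp: c_def scaleC_one\<close>)
    also have "\<dots> = (T ^^ n) e - (\<Sum>i<m. a i *C (T ^^ i) e)"
      using nm by (simp add: sum_subtractf)
    finally have c: "(\<Sum>i<m. c i *C (T ^^ i) e) \<in> W" using a(2) by simp
    \<comment> \<open>Let \<open>k\<close> be the lowest index in the relation. Applying
      \<open>T\<close> another \<open>m - 1 - k\<close> times moves all later terms into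
      \<open>W\<close> and leaves a nonzero multiple of the orbit vector with index
      \<open>m - 1\<close>, against the minimality of \<open>m\<close>.\<close>
    define k where "k = (LEAST i. c i \<noteq> 0)"
    have cn: "c n \<noteq> 0" by (simp add: c_def)
    have k: "c k \<noteq> 0" unfolding k_def by (rule LeastI[of _ n]) (rule cn)
    have "k \<le> n" unfolding k_def by (rule Least_le) (rule cn)
    then have km: "k < m" using nm by simp
    have least: "c i = 0" if "i < k" for i
      using not_less_Least[of i "\<lambda>i. c i \<noteq> 0"] that by (simp add: k_def)
    let ?j = "m - 1 - k"
    have "(T ^^ ?j) (\<Sum>i<m. c i *C (T ^^ i) e) \<in> W"
      by (rule funpow_invariant[OF W(3) c])
    also have "(T ^^ ?j) (\<Sum>i<m. c i *C (T ^^ i) e) = (\<Sum>i<m. c i *C (T ^^ (?j + i)) e)"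
      by (simp add: funpow_sum funpow_scale funpow_add)
    also have "\<dots> = c k *C (T ^^ (m - 1)) e + (\<Sum>i\<in>{..<m} - {k}. c i *C (T ^^ (?j + i)) e)"
      using km by (subst sum.remove[of _ k]) simp_all
    finally have tot: "c k *C (T ^^ (m - 1)) e + (\<Sum>i\<in>{..<m} - {k}. c i *C (T ^^ (?j + i)) e) \<in> W" .
    have "c i *C (T ^^ (?j + i)) e \<in> W" if "i \<noteq> k" for i
    proof (cases "i < k")
      case True
      then show ?thesis using least complex_vector.subspace_0[OF W(2)] by simp
    next
      case False
      then show ?thesis using that km
        by (intro complex_vector.subspace_scale[OF W(2)] above) simp
    qed
    then have "(\<Sum>i\<in>{..<m} - {k}. c i *C (T ^^ (?j + i)) e) \<in> W"
      by (intro complex_vector.subspace_sum[OF W(2)]) simp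
    from complex_vector.subspace_diff[OF W(2) tot this]
    have "c k *C (T ^^ (m - 1)) e \<in> W" by simp
    then have "inverse (c k) *C (c k *C (T ^^ (m - 1)) e) \<in> W"
      by (rule complex_vector.subspace_scale[OF W(2)])
    then have "(T ^^ (m - 1)) e \<in> W" using k by (simp add: scaleC_scaleC scaleC_one)
    then show False using below[of "m - 1"] km by simp
  qed
  ultimately obtain g K where g: "bounded_functional g K" "\<And>x. x \<in> U \<Longrightarrow> g x = 0" "g ((T ^^ n) e) = 1"
    using bounded_functional_separating[OF _ _ W(1,2) _ B] by metis
  have "(T ^^ i) e \<in> U" if "i \<noteq> n" for i
  proof (cases "i < m")
    case True
    have "(\<Sum>j<m. (if j = i then 1 else 0) *C (T ^^ j) e) = (\<Sum>j<m. if j = i then (T ^^ j) e else 0)"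
      by (rule sum.cong) (auto simp: scaleC_one)
    also have "\<dots> = (T ^^ i) e" using True by simp
    finally show ?thesis
      unfolding U_def using that complex_vector.subspace_0[OF W(2)]
      by (intro CollectI exI[of _ "\<lambda>j. if j = i then 1 else 0"]) simp
  next
    case False
    then show ?thesis using above WU by auto
  qed
  then show ?thesis using g nil WU by (intro exI[of _ g] exI[of _ K]) auto
qed


section \<open>Functionals modelled on the multiples of an infinite product\<close>

locale functional_sequence =
  fixes g :: "nat \<Rightarrow> 'a :: complex_normed_vector \<Rightarrow> complex" and K :: "nat \<Rightarrow> real"
  assumes bounded: "bounded_functional (g n) (K n)" and K_nonneg: "0 \<le> K n"
begin

text \<open>A norm bound for \<open>partial N k\<close>. The fraction is \<open>eps N\<close>,
  written out because \<open>eps\<close> is itself defined from \<open>bound\<close>.\<close>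

primrec bound :: "nat \<Rightarrow> nat \<Rightarrow> real" where
  "bound 0 = K"
| "bound (Suc N) = (\<lambda>k. bound N k +
    (1/2) ^ N / (1 + (\<Sum>j\<le>N. bound N (Suc j))) * bound N (Suc k))"

text \<open>The sum lets one number serve all \<open>k \<le> N\<close>: from \<open>N = k\<close>
  on, the step from \<open>partial N k\<close> to \<open>partial (Suc N) k\<close> has norm at most
  \<open>(1/2) ^ N\<close>. The summand 1 keeps the denominator positive.\<close>

definition eps :: "nat \<Rightarrow> real"
  where "eps N = (1/2) ^ N / (1 + (\<Sum>j\<le>N. bound N (Suc j)))"

text \<open>Identify \<open>g n\<close> with the monomial \<open>z ^ n\<close>. Then \<open>partial N k\<close> is the polynomial
  \<open>z ^ k * (\<Prod>i<N. 1 - eps i * z)\<close>, and \<open>eps N\<close> is small enough for these to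
  converge in norm for every \<open>k\<close>.\<close>

primrec partial :: "nat \<Rightarrow> nat \<Rightarrow> 'a \<Rightarrow> complex" where
  "partial 0 = g"
| "partial (Suc N) = (\<lambda>k x. partial N k x - of_real (eps N) * partial N (Suc k) x)"

text \<open>Corresponds to \<open>z ^ k * F\<close>, where \<open>F\<close> is the infinite product
  of the factors \<open>1 - eps i * z\<close>.\<close>

definition limit :: "nat \<Rightarrow> 'a \<Rightarrow> complex"
  where "limit k x = lim (\<lambda>N. partial N k x)"

lemma bound_Suc: "bound (Suc N) k = bound N k + eps N * bound N (Suc k)"
  by (simp add: eps_def)

declare bound.simps(2) [simp del]

lemma bound_nonneg: "0 \<le> bound N k"
proof (induction N arbitrary: k)
  case (Suc N)
  then have "0 \<le> eps N" unfolding eps_def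
    by (intro divide_nonneg_nonneg add_nonneg_nonneg sum_nonneg) auto
  with Suc show ?case unfolding bound_Suc by simp
qed (simp add: K_nonneg)

lemma eps_denominator_pos: "0 < 1 + (\<Sum>j\<le>N. bound N (Suc j))"
  by (intro add_pos_nonneg sum_nonneg bound_nonneg) auto

lemma eps_pos: "0 < eps N"
  unfolding eps_def by (intro divide_pos_pos eps_denominator_pos) simp

text \<open>The power of 1/2 is halved, while the denominator does not shrink: the bounds grow with
  \<open>N\<close> and the sum gets longer. Strict decrease yields distinct parameters.\<close>

lemma eps_decreasing: "eps (Suc N) < eps N"
proof -
  have "(\<Sum>j\<le>N. bound N (Suc j)) \<le> (\<Sum>j\<le>N. bound (Suc N) (Suc j))"
    unfolding bound_Suc using bound_nonneg eps_pos by (intro sum_mono) (simp add: less_imp_le)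
  also have "\<dots> \<le> (\<Sum>j\<le>Suc N. bound (Suc N) (Suc j))"
    using bound_nonneg[of "Suc N" "Suc (Suc N)"] by simp
  finally have le: "1 + (\<Sum>j\<le>N. bound N (Suc j)) \<le> 1 + (\<Sum>j\<le>Suc N. bound (Suc N) (Suc j))"
    by simp
  have "eps (Suc N) \<le> (1/2) ^ Suc N / (1 + (\<Sum>j\<le>N. bound N (Suc j)))"
    unfolding eps_def using le eps_denominator_pos[of N] eps_denominator_pos[of "Suc N"]
    by (intro divide_left_mono mult_pos_pos) simp_all
  also have "\<dots> < eps N"
    unfolding eps_def using eps_denominator_pos by (intro divide_strict_right_mono) auto
  finally show ?thesis .
qed

lemma inj_eps: "inj eps"
proof -
  have "eps m < eps n" if "n < m" for m n
    using that by (induction m) (use eps_decreasing in \<open>auto simp: less_Suc_eq intro: less_trans\<close>)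
  then show ?thesis by (metis injI less_irrefl linorder_neqE_nat)
qed

lemma eps_bound: "k \<le> N \<Longrightarrow> eps N * bound N (Suc k) \<le> (1/2) ^ N"
proof -
  assume "k \<le> N"
  then have "bound N (Suc k) \<le> (\<Sum>j\<le>N. bound N (Suc j))"
    using bound_nonneg by (intro member_le_sum) auto
  then have "bound N (Suc k) \<le> 1 + (\<Sum>j\<le>N. bound N (Suc j))" by simp
  then have "bound N (Suc k) / (1 + (\<Sum>j\<le>N. bound N (Suc j))) \<le> 1"
    using eps_denominator_pos[of N] by simp
  from mult_left_mono[OF this, of "(1/2) ^ N"] show ?thesis
    by (simp add: eps_def)
qed

lemma partial_bounded: "bounded_functional (partial N k) (bound N k)"
proof (induction N arbitrary: k)
  case (Suc N)
  have "cmod (partial (Suc N) k x) \<le> bound (Suc N) k * norm x" for x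
  proof -
    have "cmod (partial (Suc N) k x) \<le> cmod (partial N k x) + eps N * cmod (partial N (Suc k) x)"
      using norm_triangle_ineq4[of "partial N k x" "of_real (eps N) * partial N (Suc k) x"] eps_pos[of N]
      by (simp add: norm_mult)
    also have "\<dots> \<le> bound N k * norm x + eps N * (bound N (Suc k) * norm x)"
      using eps_pos[of N] by (intro add_mono mult_left_mono bounded_functional_bound Suc.IH) auto
    also have "\<dots> = bound (Suc N) k * norm x"
      unfolding bound_Suc by (simp add: algebra_simps)
    finally show ?thesis .
  qed
  moreover have "partial (Suc N) k (x + y) = partial (Suc N) k x + partial (Suc N) k y" for x y
    by (simp add: bounded_functional_add[OF Suc.IH] algebra_simps)
  moreover have "partial (Suc N) k (c *C x) = c * partial (Suc N) k x" for c x
    by (simp add: bounded_functional_scale[OF Suc.IH] algebra_simps)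
  ultimately show ?case unfolding bounded_functional_def by blast
qed (simp add: bounded)

lemma partial_step:
  assumes "k \<le> N"
  shows "cmod (partial (Suc N) k x - partial N k x) \<le> (1/2) ^ N * norm x"
proof -
  have "cmod (partial (Suc N) k x - partial N k x) = eps N * cmod (partial N (Suc k) x)"
    using eps_pos[of N] by (simp add: norm_mult)
  also have "\<dots> \<le> eps N * (bound N (Suc k) * norm x)"
    using eps_pos[of N] by (intro mult_left_mono bounded_functional_bound partial_bounded) auto
  also have "\<dots> \<le> (1/2) ^ N * norm x"
    using mult_right_mono[OF eps_bound[OF assms], of "norm x"] by (simp add: mult.assoc)
  finally show ?thesis .
qed

lemma partial_tendsto: "(\<lambda>N. partial N k x) \<longlonglongrightarrow> limit k x"
proof -
  have "summable (\<lambda>N. (1/2 :: real) ^ N * norm x)"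
    by (intro summable_mult2 summable_geometric) simp
  then have "summable (\<lambda>N. partial (Suc N) k x - partial N k x)"
    by (rule summable_comparison_test') (rule partial_step)
  from summable_LIMSEQ[OF this]
  have "(\<lambda>N. partial N k x - partial 0 k x) \<longlonglongrightarrow> (\<Sum>N. partial (Suc N) k x - partial N k x)"
    by (simp only: sum_lessThan_telescope[of "\<lambda>N. partial N k x"])
  from tendsto_add[OF this tendsto_const[of "partial 0 k x"]]
  have "convergent (\<lambda>N. partial N k x)"
    by (auto simp: convergent_def simp del: partial.simps)
  then show ?thesis unfolding limit_def by (simp add: convergent_LIMSEQ_iff)
qed

text \<open>The difference of powers is the geometric sum of \<open>(1/2) ^ i\<close> over
  \<open>k \<le> i < N\<close>, which adds up the steps from \<open>partial k k\<close> to
  \<open>partial N k\<close>.\<close>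

lemma partial_uniform_bound:
  assumes "k \<le> N"
  shows "cmod (partial N k x) \<le> (bound k k + 2 * (1/2) ^ k - 2 * (1/2) ^ N) * norm x"
  using assms
proof (induction N rule: dec_induct)
  case base
  then show ?case using bounded_functional_bound[OF partial_bounded] by simp
next
  case (step N)
  have "cmod (partial (Suc N) k x) \<le> cmod (partial N k x) + cmod (partial (Suc N) k x - partial N k x)"
    by (metis norm_triangle_sub)
  also have "\<dots> \<le> (bound k k + 2 * (1/2) ^ k - 2 * (1/2) ^ N) * norm x + (1/2) ^ N * norm x"
    using step.IH partial_step[OF step.hyps(1)] by (rule add_mono)
  also have "\<dots> = (bound k k + 2 * (1/2) ^ k - 2 * (1/2) ^ Suc N) * norm x"
    by (simp add: algebra_simps)
  finally show ?case .
qed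

lemma limit_bounded: "bounded_functional (limit k) (bound k k + 2 * (1/2) ^ k)"
proof -
  have "limit k (x + y) = limit k x + limit k y" for x y
  proof (rule LIMSEQ_unique[OF partial_tendsto])
    show "(\<lambda>N. partial N k (x + y)) \<longlonglongrightarrow> limit k x + limit k y"
      unfolding bounded_functional_add[OF partial_bounded]
      by (intro tendsto_add partial_tendsto)
  qed
  moreover have "limit k (c *C x) = c * limit k x" for c x
  proof (rule LIMSEQ_unique[OF partial_tendsto])
    show "(\<lambda>N. partial N k (c *C x)) \<longlonglongrightarrow> c * limit k x"
      unfolding bounded_functional_scale[OF partial_bounded]
      by (intro tendsto_mult tendsto_const partial_tendsto)
  qed
  moreover have "cmod (limit k x) \<le> (bound k k + 2 * (1/2) ^ k) * norm x" for x
  proof (rule LIMSEQ_le_const2[OF tendsto_norm[OF partial_tendsto]])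
    have "cmod (partial N k x) \<le> (bound k k + 2 * (1/2) ^ k) * norm x" if "k \<le> N" for N
      using partial_uniform_bound[OF that, of x] mult_right_mono[of "bound k k + 2 * (1/2) ^ k - 2 * (1/2) ^ N"
          "bound k k + 2 * (1/2) ^ k" "norm x"] by simp
    then show "\<exists>N. \<forall>n\<ge>N. cmod (partial n k x) \<le> (bound k k + 2 * (1/2) ^ k) * norm x" by blast
  qed
  ultimately show ?thesis unfolding bounded_functional_def by blast
qed

text \<open>At such \<open>x\<close>, each \<open>g n\<close> acts as \<open>l\<close> times the
  evaluation of its monomial at \<open>l\<close>, so \<open>partial N k\<close> acts as
  \<open>l\<close> times the evaluation of its polynomial.\<close>

lemma partial_at_geometric:
  assumes "\<And>n. g n x = l ^ Suc n"
  shows "partial N k x = l ^ Suc k * (\<Prod>i<N. 1 - of_real (eps i) * l)"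
  by (induction N arbitrary: k) (simp_all add: assms algebra_simps)

text \<open>Once \<open>N > j\<close>, the product contains the factor with index \<open>j\<close>,
  which vanishes at \<open>1 / eps j\<close>.\<close>

lemma limit_at_geometric:
  assumes "\<And>n. g n x = (1 / of_real (eps j)) ^ Suc n"
  shows "limit k x = 0"
proof (rule LIMSEQ_unique[OF partial_tendsto])
  have "partial N k x = 0" if "N > j" for N
    unfolding partial_at_geometric[OF assms] using that eps_pos[of j] by auto
  then show "(\<lambda>N. partial N k x) \<longlonglongrightarrow> 0"
    by (intro tendsto_eventually eventually_sequentiallyI[of "Suc j"]) simp
qed

text \<open>Evaluation at \<open>v i\<close> reads off the coefficient of \<open>z ^ i\<close>. The
  product has constant term 1, so its multiple by \<open>z ^ k\<close> starts with
  \<open>z ^ k\<close>.\<close>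

lemma limit_triangular:
  assumes delta: "\<And>n i. g n (v i) = (if i = n then 1 else 0)"
  shows "i < k \<Longrightarrow> limit k (v i) = 0" and "limit k (v k) = 1"
proof -
  have lower: "i < k \<Longrightarrow> partial N k (v i) = 0" for N k i
    by (induction N arbitrary: k) (simp_all add: delta)
  have "partial N k (v k) = 1" for N
    by (induction N) (simp_all add: delta lower)
  then show "limit k (v k) = 1" by (simp add: limit_def)
  assume "i < k"
  then show "limit k (v i) = 0" by (simp add: limit_def lower)
qed

end

section \<open>The closed span of a sequence as an almost-invariant half-space\<close>

text \<open>The functionals \<open>\<phi> k\<close> vanish on the closed span and are triangular on
  \<open>v\<close>, which gives infinite codimension. The functionals \<open>\<psi> k\<close> are
  triangular on \<open>h\<close> itself, which gives infinite dimension.\<close>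

lemma half_space_closed_span:
  fixes v h :: "nat \<Rightarrow> 'a :: complex_normed_vector"
  assumes phi: "\<And>k. bounded_functional (\<phi> k) (L k)" "\<And>k j. \<phi> k (h j) = 0"
    and v: "\<And>i k. i < k \<Longrightarrow> \<phi> k (v i) = 0" "\<And>k. \<phi> k (v k) \<noteq> 0"
    and psi: "\<And>k. bounded_functional (\<psi> k) (M k)"
      "\<And>i k. i < k \<Longrightarrow> \<psi> k (h i) = 0" "\<And>k. \<psi> k (h k) \<noteq> 0"
  shows "half_space (closure (cspan (range h)))"
proof -
  let ?Y = "closure (cspan (range h))"
  have sub: "csubspace ?Y" by (intro csubspace_closure complex_vector.subspace_span)
  have zero: "\<phi> k x = 0" if "x \<in> ?Y" for k x
  proof -
    have "cspan (range h) \<subseteq> {x. \<phi> k x = 0}"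
      by (rule complex_vector.span_minimal) (use phi bounded_functional_kernel[OF phi(1)] in auto)
    then have "?Y \<subseteq> {x. \<phi> k x = 0}"
      by (rule closure_minimal) (rule bounded_functional_kernel(1)[OF phi(1)])
    then show ?thesis using that by blast
  qed
  have "\<not> finite_cdim ?Y"
  proof
    assume "finite_cdim ?Y"
    then obtain B where B: "finite B" "cspan B = ?Y" unfolding finite_cdim_def by blast
    have "h i \<in> ?Y" for i
      using closure_subset[of "cspan (range h)"] complex_vector.span_base[of "h i" "range h"] by blast
    then have "\<exists>b\<in>cspan B. h i - b \<in> {0}" for i
      unfolding B(2) by (intro bexI[of _ "h i"]) auto
    from no_triangular_family[of "{0}" B h \<psi> M, OF _ B(1) this psi(1) _ psi(2,3)]
    show False using bounded_functional_zero[OF psi(1)] by (auto simp: complex_vector.subspace_def)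
  qed
  moreover have "\<not> finite_cdim_quotient ?Y"
  proof
    assume "finite_cdim_quotient ?Y"
    then obtain B where B: "finite B" "\<And>x. \<exists>b\<in>cspan B. x - b \<in> ?Y"
      using finite_cdim_quotient_representatives[OF _ sub] by blast
    from no_triangular_family[of ?Y B v \<phi> L, OF sub B phi(1) zero v] show False .
  qed
  ultimately show ?thesis using sub by (simp add: half_space_def closed_csubspace_def)
qed

text \<open>The same \<open>e\<close> serves every \<open>h j\<close>, so \<open>T\<close> maps the
  span into the closed span plus one line. That sum is closed, so the inclusion passes to the
  closure.\<close>

lemma almost_invariant_closed_span:
  fixes T :: "'a :: complex_banach \<Rightarrow> 'a"
  assumes T: "bounded_linear T" "endomorphism T"
    and h: "\<And>j. T (h j) = \<mu> j *C h j - e"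
  shows "almost_invariant T (closure (cspan (range h)))"
proof -
  interpret endomorphism T by fact
  let ?Y = "closure (cspan (range h))"
  let ?Z = "cspan (insert e ?Y)"
  have sub: "csubspace ?Y" by (intro csubspace_closure complex_vector.subspace_span)
  then have span: "cspan ?Y = ?Y" by simp
  have closed: "closed ?Z" by (rule closed_cspan_insert) (simp add: span)
  have "T (h j) \<in> ?Z" for j
  proof -
    have "h j \<in> ?Y"
      using closure_subset[of "cspan (range h)"] complex_vector.span_base[of "h j" "range h"] by blast
    then show ?thesis unfolding h
      by (intro complex_vector.span_diff complex_vector.span_scale complex_vector.span_base) auto
  qed
  moreover have "csubspace (T -` ?Z)"
    by (rule complex_vector.subspaceI)
      (auto simp: add scale zero complex_vector.span_zero
        intro: complex_vector.span_add complex_vector.span_scale)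
  ultimately have "cspan (range h) \<subseteq> T -` ?Z"
    by (intro complex_vector.span_minimal) auto
  then have "T ` cspan (range h) \<subseteq> ?Z" by blast
  then have "closure (T ` cspan (range h)) \<subseteq> ?Z" using closed by (rule closure_minimal)
  then have TY: "T ` ?Y \<subseteq> ?Z"
    using closure_bounded_linear_image_subset[OF T(1), of "cspan (range h)"] by blast
  have "T ` ?Y \<subseteq> {y + m |y m. y \<in> ?Y \<and> m \<in> cspan {e}}"
  proof
    fix z assume "z \<in> T ` ?Y"
    then have "z \<in> ?Z" using TY by blast
    then obtain k where "z - k *C e \<in> ?Y"
      unfolding complex_vector.span_insert span by blast
    moreover have "k *C e \<in> cspan {e}"
      by (intro complex_vector.span_scale complex_vector.span_base) simp
    moreover have "z = (z - k *C e) + k *C e" by simp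
    ultimately show "z \<in> {y + m |y m. y \<in> ?Y \<and> m \<in> cspan {e}}" by blast
  qed
  moreover have "closed (cspan {e})"
    by (rule closed_cspan_insert) simp
  moreover have "finite_cdim (cspan {e})"
    unfolding finite_cdim_def by (intro exI[of _ "{e}"]) simp
  ultimately show ?thesis
    unfolding almost_invariant_def closed_csubspace_def using sub
    by (intro conjI exI[of _ "cspan {e}"]) simp_all
qed

section \<open>Maximal chains of closed subspaces\<close>

lemma maxchain_comparable_mem:
  assumes "subset.maxchain A C" "Z \<in> A" "\<And>Y. Y \<in> C \<Longrightarrow> Z \<subseteq> Y \<or> Y \<subseteq> Z"
  shows "Z \<in> C"
proof (rule ccontr)
  assume "Z \<notin> C"
  moreover have "subset.chain A (insert Z C)"
    using assms pred_on.maxchain_imp_chain[of A "(\<subset>)" C]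
    by (auto simp: subset_chain_def subset.maxchain_def)
  ultimately show False
    using assms(1) unfolding subset.maxchain_def by blast
qed

text \<open>If \<open>v\<close> lay in every nonzero member, the line through \<open>v\<close> would
  be comparable with every member, and maximality would put it into the chain.\<close>

lemma maxchain_separates:
  fixes C :: "'a :: complex_banach set set"
  assumes max: "subset.maxchain {Y. closed_csubspace Y} C"
    and no_line: "\<And>u. u \<noteq> 0 \<Longrightarrow> cspan {u} \<notin> C"
    and v: "v \<noteq> 0"
  shows "\<exists>W\<in>C. W \<noteq> {0} \<and> v \<notin> W"
proof (rule ccontr)
  assume neg: "\<not> ?thesis"
  define I where "I = \<Inter>{Y \<in> C. Y \<noteq> {0}}"
  have closed: "closed_csubspace Y" if "Y \<in> C" for Y
    using max that by (auto simp: subset.maxchain_def subset_chain_def)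
  have "closed_csubspace I"
    unfolding closed_csubspace_def I_def using closed
    by (auto intro!: closed_Inter complex_vector.subspace_Inter simp: closed_csubspace_def)
  have vI: "v \<in> I" using neg unfolding I_def by blast
  have line: "cspan {v} \<subseteq> Y" if "closed_csubspace Y" "v \<in> Y" for Y
    using that by (intro complex_vector.span_minimal) (auto simp: closed_csubspace_def)
  have "cspan {v} \<in> C"
  proof (rule maxchain_comparable_mem[OF max])
    have "closed (cspan {v})" by (rule closed_cspan_insert) simp
    then show "cspan {v} \<in> {Y. closed_csubspace Y}"
      by (simp add: closed_csubspace_def)
  next
    fix Y assume Y: "Y \<in> C"
    show "cspan {v} \<subseteq> Y \<or> Y \<subseteq> cspan {v}"
    proof (cases "Y = {0}")
      case True
      then show ?thesis using complex_vector.span_zero by auto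
    next
      case False
      then have "v \<in> Y" using Y vI unfolding I_def by blast
      then show ?thesis using line closed[OF Y] by blast
    qed
  qed
  then show False using no_line v by blast
qed

theorem theorem2p4:
  fixes T :: "'a :: complex_banach \<Rightarrow> 'a"
  assumes "\<not> finite_cdim (UNIV :: 'a set)"
    and "bounded_clinear T"
    and "triangularizable T"
    and "quasinilpotent T"
    and "inj T"
  shows "\<exists>Y. half_space Y \<and> almost_invariant T Y"
proof -
  have bl: "bounded_linear T" and lin: "Vector_Spaces.linear scaleC scaleC T"
    using assms(2) by (auto simp: bounded_clinear_def)
  have T: "endomorphism T"
    using lin by unfold_locales (simp_all add: Vector_Spaces.linear_iff)
  interpret endomorphism T by (rule T)
  have resolvent: "\<exists>S. (\<forall>x. S (T x - a *C x) = x) \<and> (\<forall>x. T (S x) - a *C S x = x)" if "a \<noteq> 0" for a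
    using assms(4) that unfolding quasinilpotent_def spectrum_def by blast
  \<comment> \<open>Injectivity excludes the eigenvalue 0, quasinilpotence all others.\<close>
  have eig: "y = 0" if "T y = a *C y" for a y
  proof (cases "a = 0")
    case True
    then have "T y = T 0" using that by (simp add: zero)
    then show ?thesis using assms(5) by (simp add: inj_eq)
  next
    case False
    then obtain S where S: "\<And>x. S (T x - a *C x) = x" using resolvent by blast
    have "S 0 = y" "S 0 = 0" using S[of y] S[of 0] that by (simp_all add: zero)
    then show ?thesis by simp
  qed
  obtain \<C> where C: "subset.maxchain {Y. closed_csubspace Y} \<C>" "\<And>Y. Y \<in> \<C> \<Longrightarrow> T ` Y \<subseteq> Y"
    using assms(3) unfolding triangularizable_def by blast
  have closed: "closed Y" "csubspace Y" if "Y \<in> \<C>" for Y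
    using C(1) that by (auto simp: subset.maxchain_def subset_chain_def closed_csubspace_def)
  show ?thesis
  proof (cases "\<exists>Y\<in>\<C>. half_space Y")
    case True
    then obtain Y where Y: "Y \<in> \<C>" "half_space Y" by blast
    have "finite_cdim ({0} :: 'a set)"
      unfolding finite_cdim_def by (intro exI[of _ "{}"]) simp
    \<comment> \<open>Members of the chain are invariant, so the zero subspace serves as the
      finite-dimensional defect.\<close>
    then have "almost_invariant T Y"
      unfolding almost_invariant_def closed_csubspace_def using closed[OF Y(1)] C(2)[OF Y(1)]
      by (intro conjI exI[of _ "{0}"]) (auto simp: complex_vector.subspace_def)
    then show ?thesis using Y(2) by blast
  next
    case False
    have triv: "Y = {0}" if Y: "Y \<in> \<C>" "finite_cdim Y" for Y
    proof -
      have "y = 0" if "y \<in> Y" for y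
        by (rule finite_dimensional_invariant_trivial[OF _ Y(2) C(2)[OF Y(1)] that]) (rule eig)
      then show ?thesis using complex_vector.subspace_0[OF closed(2)[OF Y(1)]] by blast
    qed
    have finite_codim: "finite_cdim_quotient Y" if "Y \<in> \<C>" "Y \<noteq> {0}" for Y
      using False triv closed that by (auto simp: half_space_def closed_csubspace_def)
    have separate: "\<exists>W\<in>\<C>. W \<noteq> {0} \<and> v \<notin> W" if "v \<noteq> 0" for v
    proof (rule maxchain_separates[OF C(1) _ that])
      fix u :: 'a assume "u \<noteq> 0"
      show "cspan {u} \<notin> \<C>"
      proof
        assume "cspan {u} \<in> \<C>"
        moreover have "finite_cdim (cspan {u})"
          unfolding finite_cdim_def by (intro exI[of _ "{u}"]) simp
        ultimately have "cspan {u} = {0}" using triv by blast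
        then show False using \<open>u \<noteq> 0\<close> complex_vector.span_base[of u "{u}"] by simp
      qed
    qed
    have "(UNIV :: 'a set) \<noteq> cspan {}" using assms(1) unfolding finite_cdim_def by blast
    then obtain e :: 'a where e: "e \<noteq> 0" by auto
    have orbit: "(T ^^ n) e \<noteq> 0" for n
      by (induction n) (use e eig[of _ 0] in auto)
    have surj: "surj (\<lambda>x. T x - a *C x)" if "a \<noteq> 0" for a
      using resolvent[OF that] by (metis surjI)
    \<comment> \<open>Each \<open>n\<close> has its own \<open>W\<close>, chosen to miss the orbit
      vector with index \<open>n\<close>; hence \<open>M\<close> also depends on
      \<open>n\<close>.\<close>
    have "\<exists>g K M. bounded_functional g K \<and> (\<forall>i. g ((T ^^ i) e) = (if i = n then 1 else 0)) \<and>
      (\<forall>x. g ((T ^^ M) x) = 0)" for n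
    proof -
      obtain W where W: "W \<in> \<C>" "W \<noteq> {0}" "(T ^^ n) e \<notin> W"
        using separate[OF orbit] by blast
      obtain B where B: "finite B" "\<And>x. \<exists>b\<in>cspan B. x - b \<in> W"
        using finite_cdim_quotient_representatives[OF finite_codim[OF W(1,2)] closed(2)[OF W(1)]] by blast
      obtain M where "\<And>x. (T ^^ M) x \<in> W"
        using uniformly_nilpotent_modulo[OF closed(2)[OF W(1)] C(2)[OF W(1)] surj B] by blast
      from biorthogonal_functional[OF T closed[OF W(1)] C(2)[OF W(1)] B this W(3)]
      show ?thesis by blast
    qed
    then obtain g K M where g: "\<And>n. bounded_functional (g n) (K n)"
      "\<And>n i. g n ((T ^^ i) e) = (if i = n then 1 else 0)" "\<And>n x. g n ((T ^^ M n) x) = 0"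
      by metis
    interpret functional_sequence g "\<lambda>n. \<bar>K n\<bar>"
    proof
      have "K n * norm x \<le> \<bar>K n\<bar> * norm x" for n x by (intro mult_right_mono) auto
      then show "bounded_functional (g n) \<bar>K n\<bar>" for n
        using g(1)[of n] unfolding bounded_functional_def by (meson order_trans)
    qed simp
    \<comment> \<open>The vector \<open>h\<close> is the inverse of \<open>eps j - T\<close> applied
      to \<open>e\<close>. Since \<open>S\<close> inverts \<open>T - eps j\<close>, it is applied to
      \<open>- e\<close>.\<close>
    have "\<exists>h. T h = of_real (eps j) *C h - e" for j
    proof -
      have "complex_of_real (eps j) \<noteq> 0" using eps_pos[of j] by simp
      then obtain S where "\<And>x. T (S x) - of_real (eps j) *C S x = x" using resolvent by blast
      then have "T (S (- e)) = of_real (eps j) *C S (- e) - e" by (simp add: diff_eq_eq)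
      then show ?thesis by blast
    qed
    then obtain h where h: "\<And>j. T (h j) = of_real (eps j) *C h j - e" by metis
    have gh: "g n (h j) = (1 / of_real (eps j)) ^ Suc n" for n j
    proof (rule functional_at_resolvent[OF T g])
      have "h j = (1 / of_real (eps j)) *C (of_real (eps j) *C h j)"
        using eps_pos[of j] by (simp add: scaleC_scaleC scaleC_one)
      also have "of_real (eps j) *C h j = e + T (h j)" by (simp add: h)
      finally show "h j = (1 / of_real (eps j)) *C e + (1 / of_real (eps j)) *C T (h j)"
        by (simp add: scaleC_add_right)
    qed
    have "half_space (closure (cspan (range h)))"
    proof (rule half_space_closed_span[where \<phi> = limit and v = "\<lambda>i. (T ^^ i) e"
          and \<psi> = "\<lambda>k. partial k 0"])
      show "limit k (h j) = 0" for k j by (rule limit_at_geometric) (rule gh)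
      show "limit k ((T ^^ i) e) = 0" if "i < k" for i k by (rule limit_triangular(1)[of "\<lambda>i. (T ^^ i) e", OF g(2) that])
      show "limit k ((T ^^ k) e) \<noteq> 0" for k
        using limit_triangular(2)[of "\<lambda>i. (T ^^ i) e", OF g(2)] by simp
      \<comment> \<open>Up to a nonzero factor, the value of \<open>partial k 0\<close> at
        \<open>h i\<close> is the product of \<open>1 - eps j / eps i\<close> over
        \<open>j < k\<close>. It contains the factor 0 if \<open>i < k\<close>; for
        \<open>i = k\<close> it is nonzero because the parameters are distinct.\<close>
      show "partial k 0 (h i) = 0" if "i < k" for i k
        unfolding partial_at_geometric[OF gh] using that eps_pos[of i] by auto
      show "partial k 0 (h k) \<noteq> 0" for k
      proof -
        have "1 - complex_of_real (eps i) * (1 / of_real (eps k)) \<noteq> 0" if "i < k" for i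
        proof -
          have "eps i \<noteq> eps k" using inj_eps that by (auto simp: inj_def)
          then show ?thesis using eps_pos[of k] by (simp add: field_simps)
        qed
        then show ?thesis
          unfolding partial_at_geometric[OF gh] using eps_pos[of k] by simp
      qed
    qed (rule limit_bounded partial_bounded)+
    moreover have "almost_invariant T (closure (cspan (range h)))"
      by (rule almost_invariant_closed_span[OF bl T h])
    ultimately show ?thesis by blast
  qed
qed


end
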